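(* Consider the real planar cubic system \[ \dot\xi = P_3(y)+P_1(y)\xi,\qquad \dot y = -\xi - P_2(y), \] with \[ P_1(y)=a_0+a_1y,\qquad P_2(y)=b_1y+b_2y^2,\qquad P_3(y)=c_1y+c_2y^2+c_3y^3 . \] This system has a non-degenerate center at the origin if and only if $a_0-b_1=0$, $c_1-a_0b_1>0$, and at least one of the following holds: (i) $a_1-2b_2=0$ (Hamiltonian case); (ii) $c_2-a_0(a_1+b_2)=0$ (pull-back case).
   Context: A non-degenerate center is a singular point whose linearization has purely imaginary nonzero eigenvalues and whose nearby orbits are all closed. *)

theory Defs
  imports "HOL-Analysis.Analysis"
begin

definition jac11 :: "(real \<times> real \<Rightarrow> real \<times> real) \<Rightarrow> real \<times> real \<Rightarrow> real" where
  "jac11 F p = fst (frechet_derivative F (at p) (1, 0))"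
definition jac12 :: "(real \<times> real \<Rightarrow> real \<times> real) \<Rightarrow> real \<times> real \<Rightarrow> real" where
  "jac12 F p = fst (frechet_derivative F (at p) (0, 1))"
definition jac21 :: "(real \<times> real \<Rightarrow> real \<times> real) \<Rightarrow> real \<times> real \<Rightarrow> real" where
  "jac21 F p = snd (frechet_derivative F (at p) (1, 0))"
definition jac22 :: "(real \<times> real \<Rightarrow> real \<times> real) \<Rightarrow> real \<times> real \<Rightarrow> real" where
  "jac22 F p = snd (frechet_derivative F (at p) (0, 1))"

definition lin_eigenvalue :: "(real \<times> real \<Rightarrow> real \<times> real) \<Rightarrow> real \<times> real \<Rightarrow> complex \<Rightarrow> bool" where
  "lin_eigenvalue F p mu \<longleftrightarrow>
     (mu - of_real (jac11 F p)) * (mu - of_real (jac22 F p))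
       - of_real (jac12 F p) * of_real (jac21 F p) = 0"

definition closed_orbit_through :: "(real \<times> real \<Rightarrow> real \<times> real) \<Rightarrow> real \<times> real \<Rightarrow> bool" where
  "closed_orbit_through F q \<longleftrightarrow>
     (\<exists>x :: real \<Rightarrow> real \<times> real. \<exists>T > 0.
        x 0 = q \<and>
        (\<forall>t. (x has_vector_derivative F (x t)) (at t)) \<and>
        (\<forall>t. x (t + T) = x t) \<and>
        (\<exists>t. x t \<noteq> q))"

definition nondegenerate_center :: "(real \<times> real \<Rightarrow> real \<times> real) \<Rightarrow> real \<times> real \<Rightarrow> bool" where
  "nondegenerate_center F p \<longleftrightarrow>
     F p = 0 \<and> F differentiable (at p) \<and>
     (\<forall>mu. lin_eigenvalue F p mu \<longrightarrow> Re mu = 0 \<and> mu \<noteq> 0) \<and>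
     (\<exists>r > 0. \<forall>q. 0 < dist q p \<and> dist q p < r \<longrightarrow> closed_orbit_through F q)"

end

theory Submission
  imports Defs
begin

text \<open>With \<open>v = - \<xi> - P\<^sub>2(y)\<close> the system becomes the Lienard system \<open>y' = v\<close>, \<open>v' = - g(y) + f(y) v\<close>, where
  \<open>g = P\<^sub>3 - P\<^sub>1 P\<^sub>2\<close> and \<open>f = P\<^sub>1 - P\<^sub>2'\<close>. The linear part at the origin has trace \<open>a\<^sub>0 - b\<^sub>1\<close> and determinant
  \<open>c\<^sub>1 - a\<^sub>0 b\<^sub>1\<close>; once the trace vanishes, \<open>f(y) = k y\<close> with \<open>k = a\<^sub>1 - 2 b\<^sub>2\<close>, and the quadratic coefficient of \<open>g\<close>
  is \<open>c\<^sub>2 - a\<^sub>0 (a\<^sub>1 + b\<^sub>2)\<close>. If \<open>k = 0\<close> the system is reversible under \<open>v \<mapsto> - v\<close>, and if \<open>g\<close> is odd it is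
  reversible under \<open>y \<mapsto> - y\<close>; in both cases every orbit near the origin crosses the symmetry axis
  repeatedly and is therefore closed. If neither holds, a quartic Lyapunov function decreases
  strictly in one time direction; orbits that start near the origin are trapped by it and cannot
  close up.\<close>

section \<open>Solutions of Lipschitz vector fields\<close>

lemma has_vector_derivative_reflect:
  fixes x :: "real \<Rightarrow> 'a::real_normed_vector"
  assumes "(x has_vector_derivative x') (at (c - t))"
  shows "((\<lambda>t. x (c - t)) has_vector_derivative - x') (at t)"
proof -
  have "((\<lambda>t. c - t) has_vector_derivative - 1) (at t)"
    by (auto intro!: derivative_eq_intros)
  from vector_diff_chain_at[OF this assms] show ?thesis
    by (simp add: o_def)
qed

lemma has_vector_derivative_shift:
  fixes x :: "real \<Rightarrow> 'a::real_normed_vector"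
  assumes "(x has_vector_derivative x') (at (c + t))"
  shows "((\<lambda>t. x (c + t)) has_vector_derivative x') (at t)"
proof -
  have "((\<lambda>t. c + t) has_vector_derivative 1) (at t)"
    by (auto intro!: derivative_eq_intros)
  from vector_diff_chain_at[OF this assms] show ?thesis
    by (simp add: o_def)
qed

text \<open>The comparison function \<open>C / K * exp (K * t)\<close> has the assumed bound as its
  derivative, so the mean value inequality settles positive times; negative times follow by
  reflecting \<open>F\<close>. The factor \<open>1 / K\<close> gained by integrating an exponential
  is what makes the Picard operator below a contraction.\<close>

lemma antiderivative_exp_bound:
  fixes F f :: "real \<Rightarrow> 'a::real_normed_vector"
  assumes K: "0 < K"
    and F: "\<And>t. (F has_vector_derivative f t) (at t)"
    and f: "\<And>t. norm (f t) \<le> C * exp (K * \<bar>t\<bar>)"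
  shows "norm (F t - F 0) \<le> C / K * (exp (K * \<bar>t\<bar>) - 1)"
proof -
  have forward: "norm (G t - G 0) \<le> C / K * (exp (K * t) - 1)"
    if "0 \<le> t" and G: "\<And>t. (G has_vector_derivative g t) (at t)"
      and g: "\<And>t. norm (g t) \<le> C * exp (K * \<bar>t\<bar>)" for t and G g :: "real \<Rightarrow> 'a"
  proof -
    have "norm (G t - G 0) \<le> C / K * exp (K * t) - C / K * exp (K * 0)"
    proof (cases "t = 0")
      case False
      show ?thesis
      proof (rule differentiable_bound_general)
        show "0 < t"
          using that False by simp
        show "continuous_on {0..t} G"
          using G by (meson continuous_at_imp_continuous_on has_vector_derivative_continuous)
        show "continuous_on {0..t} (\<lambda>t. C / K * exp (K * t))"
          by (intro continuous_intros)
        show "(G has_vector_derivative g s) (at s)" for s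
          by (rule G)
        show "((\<lambda>t. C / K * exp (K * t)) has_vector_derivative C * exp (K * s)) (at s)" for s
          unfolding has_real_derivative_iff_has_vector_derivative[symmetric]
          using K by (auto intro!: derivative_eq_intros)
        show "norm (g s) \<le> C * exp (K * s)" if "0 < s" for s
          using g[of s] that by simp
      qed
    qed simp
    then show ?thesis
      by (simp add: algebra_simps)
  qed
  show ?thesis
  proof (cases "0 \<le> t")
    case True
    then show ?thesis
      using forward[OF True F f] by simp
  next
    case False
    have "((\<lambda>t. F (- t)) has_vector_derivative - f (- t)) (at t)" for t
      using has_vector_derivative_reflect[of F "f (- t)" 0 t] F by simp
    from forward[OF _ this, of "- t"] f False show ?thesis
      by (metis abs_minus_cancel abs_of_neg add.inverse_inverse less_le neg_0_le_iff_le
          minus_zero norm_minus_cancel not_le)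
  qed
qed

text \<open>Picard iteration in a supremum norm with exponential weight (Bielecki's norm): the
  integral operator is then a contraction on the whole real line at once, and no local solutions
  have to be glued. The solution is sought as \<open>w\<close> times a bounded continuous function
  \<open>u\<close>.\<close>

theorem lipschitz_global_solution:
  fixes X :: "'a::euclidean_space \<Rightarrow> 'a"
  assumes lip: "L-lipschitz_on UNIV X"
  obtains x where "x 0 = q" "\<And>t. (x has_vector_derivative X (x t)) (at t)"
proof -
  \<comment> \<open>In the weight \<open>exp (K * \<bar>t\<bar>)\<close> the integral operator
    contracts by \<open>L / K\<close>. The summand \<open>2 * L\<close> makes this at most 1/2, and
    the summand 1 keeps \<open>K\<close> positive when \<open>L = 0\<close>.\<close>
  define K where "K = 2 * L + 1"
  have L: "0 \<le> L"
    using lip by (rule lipschitz_on_nonneg)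
  have K: "0 < K" "L / K \<le> 1 / 2"
    using L by (auto simp: K_def field_simps)
  define w :: "real \<Rightarrow> real" where "w t = exp (K * \<bar>t\<bar>)" for t
  have w: "0 < w t" "w t \<noteq> 0" "1 \<le> w t" for t
    using K by (auto simp: w_def)
  have cont_w: "continuous_on UNIV w"
    unfolding w_def by (intro continuous_intros)
  have cont_X: "continuous_on UNIV X"
    using lip by (rule lipschitz_on_continuous_on)
  have Xd: "norm (X p - X p') \<le> L * norm (p - p')" for p p'
    using lipschitz_onD[OF lip, of p p'] by (simp add: dist_norm)
  have cont_f: "continuous_on UNIV (\<lambda>t. X (w t *\<^sub>R apply_bcontfun u t))" for u :: "real \<Rightarrow>\<^sub>C 'a"
    by (rule continuous_on_compose2[OF cont_X]) (auto intro!: continuous_intros cont_w)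
  have "\<exists>F. F 0 = 0 \<and> (\<forall>t. (F has_vector_derivative X (w t *\<^sub>R apply_bcontfun u t)) (at t))"
    for u :: "real \<Rightarrow>\<^sub>C 'a"
  proof -
    have "isCont (\<lambda>t. X (w t *\<^sub>R apply_bcontfun u t)) t" for t
      using cont_f by (simp add: continuous_on_eq_continuous_at)
    then obtain F where F: "\<And>t. (F has_vector_derivative X (w t *\<^sub>R apply_bcontfun u t)) (at t)"
      using einterval_antiderivative[of "-\<infinity>" "\<infinity>" "\<lambda>t. X (w t *\<^sub>R apply_bcontfun u t)"] by auto
    show ?thesis
      by (rule exI[of _ "\<lambda>t. F t - F 0"]) (auto intro!: derivative_eq_intros F)
  qed
  then obtain A where A0: "\<And>u. A u 0 = 0"
    and A: "\<And>u t. (A u has_vector_derivative X (w t *\<^sub>R apply_bcontfun u t)) (at t)"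
    by metis
  \<comment> \<open>The Picard operator divided by the weight, so that it acts on bounded functions;
    a fixed point \<open>u\<close> yields the solution \<open>q + A u t\<close>.\<close>
  define P where "P u = (\<lambda>t. (q + A u t) /\<^sub>R w t)" for u
  have P: "P u \<in> bcontfun" for u
  proof (rule bcontfun_normI)
    have "continuous_on UNIV (A u)"
      using A by (meson continuous_at_imp_continuous_on has_vector_derivative_continuous)
    then show "continuous_on UNIV (P u)"
      unfolding P_def by (intro continuous_intros cont_w) (auto simp: w)
    let ?C = "norm (X 0) + L * norm u"
    fix t
    have "norm (X (w t *\<^sub>R apply_bcontfun u t)) \<le> ?C * exp (K * \<bar>t\<bar>)" for t
    proof -
      have "norm (X (w t *\<^sub>R apply_bcontfun u t)) \<le> norm (X 0) + L * (w t * norm (apply_bcontfun u t))"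
        using Xd[of "w t *\<^sub>R apply_bcontfun u t" 0] norm_triangle_sub[of "X (w t *\<^sub>R apply_bcontfun u t)" "X 0"]
          w[of t] by simp
      also have "\<dots> \<le> norm (X 0) * w t + L * (w t * norm u)"
        using w[of t] L
        by (intro add_mono mult_left_mono) (auto simp: norm_bounded mult_le_cancel_left1)
      finally show ?thesis
        by (simp add: w_def algebra_simps)
    qed
    from antiderivative_exp_bound[OF K(1) A this, of t]
    have "norm (A u t) \<le> ?C / K * (w t - 1)"
      by (simp add: A0 w_def)
    also have "\<dots> \<le> ?C / K * w t"
      using L K by (intro mult_left_mono divide_nonneg_pos add_nonneg_nonneg mult_nonneg_nonneg) auto
    finally have "norm (A u t) \<le> ?C / K * w t" .
    then have "norm (q + A u t) \<le> norm q * w t + ?C / K * w t"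
      using w[of t] by (intro norm_triangle_le add_mono) (auto simp: mult_le_cancel_left1)
    also have "\<dots> = w t * (norm q + ?C / K)"
      by (simp add: algebra_simps)
    finally show "norm (P u t) \<le> norm q + ?C / K"
      using w[of t] by (simp add: P_def pos_divide_le_eq divide_inverse_commute[symmetric] mult.commute[of _ "w t"])
  qed
  have contraction: "dist (Bcontfun (P u)) (Bcontfun (P v)) \<le> 1 / 2 * dist u v" for u v
  proof (rule dist_bound)
    fix t
    have "norm (X (w t *\<^sub>R apply_bcontfun u t) - X (w t *\<^sub>R apply_bcontfun v t))
        \<le> L * dist u v * exp (K * \<bar>t\<bar>)" for t
    proof -
      have "norm (X (w t *\<^sub>R apply_bcontfun u t) - X (w t *\<^sub>R apply_bcontfun v t))
          \<le> L * (w t * dist (apply_bcontfun u t) (apply_bcontfun v t))"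
        using Xd[of "w t *\<^sub>R apply_bcontfun u t" "w t *\<^sub>R apply_bcontfun v t"] w[of t]
        by (simp add: dist_norm flip: scaleR_diff_right)
      also have "\<dots> \<le> L * (w t * dist u v)"
        using L w[of t] by (intro mult_left_mono dist_bounded) auto
      finally show ?thesis
        by (simp add: w_def mult_ac)
    qed
    from antiderivative_exp_bound[OF K(1) has_vector_derivative_diff[OF A A] this, of t]
    have "norm (A u t - A v t) \<le> L / K * (dist u v * (w t - 1))"
      by (simp add: A0 w_def)
    also have "\<dots> \<le> 1 / 2 * (dist u v * w t)"
      using K(2) w[of t] by (intro mult_mono) auto
    finally have "norm (P u t - P v t) \<le> 1 / 2 * dist u v"
      using w[of t] by (simp add: P_def divide_inverse_commute[symmetric] pos_divide_le_eq flip: scaleR_diff_right)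
    then show "dist (apply_bcontfun (Bcontfun (P u)) t) (apply_bcontfun (Bcontfun (P v)) t)
        \<le> 1 / 2 * dist u v"
      by (simp add: Bcontfun_inverse P dist_norm)
  qed
  obtain u where u: "Bcontfun (P u) = u"
    using banach_fix_type[of "1 / 2" "\<lambda>u. Bcontfun (P u)"] contraction by auto
  have "apply_bcontfun u t = P u t" for t
    using u P Bcontfun_inverse by metis
  then have *: "w t *\<^sub>R apply_bcontfun u t = q + A u t" for t
    using w[of t] by (simp add: P_def)
  show thesis
  proof
    show "q + A u 0 = q"
      by (simp add: A0)
    show "((\<lambda>t. q + A u t) has_vector_derivative X (q + A u t)) (at t)" for t
      using A[of u t] by (auto intro!: derivative_eq_intros simp: *)
  qed
qed

text \<open>Gronwall's argument: \<open>exp (- 2 * L * t)\<close> times the squared norm is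
  nonincreasing, and reflection handles negative times. Only the radial component
  \<open>inner (x t) (x' t)\<close> is bounded, so a rotation in the vector field costs
  nothing.\<close>

lemma norm_growth_bound:
  fixes x :: "real \<Rightarrow> 'a::real_inner"
  assumes x: "\<And>t. (x has_vector_derivative x' t) (at t)"
    and le: "\<And>t. \<bar>inner (x t) (x' t)\<bar> \<le> L * (norm (x t))\<^sup>2"
  shows "norm (x t) \<le> exp (L * \<bar>t\<bar>) * norm (x 0)"
proof -
  have forward: "norm (y t) \<le> exp (L * t) * norm (y 0)"
    if "0 \<le> t" and y: "\<And>t. (y has_vector_derivative y' t) (at t)"
      and le: "\<And>t. inner (y t) (y' t) \<le> L * (norm (y t))\<^sup>2" for t and y y' :: "real \<Rightarrow> 'a"
  proof -
    let ?h = "\<lambda>t. exp (- 2 * L * t) * inner (y t) (y t)"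
    have "?h t \<le> ?h 0"
    proof (rule DERIV_nonpos_imp_nonincreasing[OF \<open>0 \<le> t\<close>])
      fix t
      have "(?h has_real_derivative exp (- 2 * L * t) * (2 * (inner (y t) (y' t) - L * (norm (y t))\<^sup>2))) (at t)"
        using y[of t] unfolding has_vector_derivative_def has_field_derivative_def
        by (auto intro!: derivative_eq_intros ext
            simp: algebra_simps inner_commute power2_norm_eq_inner)
      then show "\<exists>y. (?h has_real_derivative y) (at t) \<and> y \<le> 0"
        using le[of t]
        by (intro exI[of _ "exp (- 2 * L * t) * (2 * (inner (y t) (y' t) - L * (norm (y t))\<^sup>2))"])
          (simp add: mult_le_0_iff)
    qed
    then have "(exp (- L * t) * norm (y t))\<^sup>2 \<le> (norm (y 0))\<^sup>2"
      by (simp add: power_mult_distrib power2_norm_eq_inner flip: exp_of_nat_mult)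
        (simp add: mult_ac)
    then have "exp (- L * t) * norm (y t) \<le> norm (y 0)"
      by (rule power2_le_imp_le) simp
    then show ?thesis
      by (simp add: exp_minus field_simps)
  qed
  show ?thesis
  proof (cases "0 \<le> t")
    case True
    have "inner (x t) (x' t) \<le> L * (norm (x t))\<^sup>2" for t
      using le[of t] by linarith
    from forward[OF True x this] show ?thesis
      using True by simp
  next
    case False
    have "((\<lambda>t. x (0 - t)) has_vector_derivative - x' (0 - t)) (at t)" for t
      by (rule has_vector_derivative_reflect[OF x])
    moreover have "inner (x (0 - t)) (- x' (0 - t)) \<le> L * (norm (x (0 - t)))\<^sup>2" for t
      using le[of "- t"] by (simp add: abs_le_iff)
    ultimately show ?thesis
      using forward[of "- t" "\<lambda>t. x (0 - t)" "\<lambda>t. - x' (0 - t)"] False by simp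
  qed
qed

text \<open>By Cauchy-Schwarz the difference of two solutions satisfies the radial bound, hence it
  cannot grow away from its value 0 at time \<open>c\<close>.\<close>

theorem lipschitz_solution_unique:
  fixes X :: "'a::real_inner \<Rightarrow> 'a"
  assumes lip: "L-lipschitz_on UNIV X"
    and x: "\<And>t. (x has_vector_derivative X (x t)) (at t)"
    and y: "\<And>t. (y has_vector_derivative X (y t)) (at t)"
    and eq: "x c = y c"
  shows "x t = y t"
proof -
  have "norm (x (c + (t - c)) - y (c + (t - c)))
      \<le> exp (L * \<bar>t - c\<bar>) * norm (x (c + 0) - y (c + 0))"
  proof (rule norm_growth_bound)
    show "((\<lambda>t. x (c + t) - y (c + t)) has_vector_derivative X (x (c + t)) - X (y (c + t))) (at t)" for t
      by (intro has_vector_derivative_diff has_vector_derivative_shift x y)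
    fix t
    let ?p = "x (c + t)" and ?p' = "y (c + t)"
    have "\<bar>inner (?p - ?p') (X ?p - X ?p')\<bar> \<le> norm (?p - ?p') * norm (X ?p - X ?p')"
      by (rule Cauchy_Schwarz_ineq2)
    also have "\<dots> \<le> norm (?p - ?p') * (L * norm (?p - ?p'))"
      using lipschitz_onD[OF lip, of ?p ?p'] by (intro mult_left_mono) (auto simp: dist_norm)
    finally show "\<bar>inner (?p - ?p') (X ?p - X ?p')\<bar> \<le> L * (norm (?p - ?p'))\<^sup>2"
      by (simp add: power2_eq_square mult_ac)
  qed
  then show ?thesis
    using eq by simp
qed

section \<open>Closed orbits of reversible systems\<close>

text \<open>Reversibility: a solution that meets the axis at two times is symmetric about
  both, hence periodic. Being a small perturbation of a rotation forces the meetings.\<close>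
theorem reversible_rotation_periodic:
  fixes M :: "complex \<Rightarrow> complex"
  assumes \<omega>: "0 < \<omega>"
    and lip: "(\<omega> / 64)-lipschitz_on UNIV M"
    and M0: "M 0 = 0"
    and rev: "\<And>z. M (cnj z) = - cnj (M z)"
    and q: "q \<noteq> 0"
  obtains z T where "0 < T" "z 0 = q"
    "\<And>t. (z has_vector_derivative - \<i> * of_real \<omega> * z t + M (z t)) (at t)"
    "\<And>t. z (t + T) = z t" "\<exists>t. z t \<noteq> q" "\<And>t. norm (z t) \<le> 2 * norm q"
proof -
  define X where "X z = - \<i> * of_real \<omega> * z + M z" for z
  define \<epsilon> where "\<epsilon> = \<omega> / 64"
  have \<epsilon>: "0 < \<epsilon>"
    using \<omega> by (simp add: \<epsilon>_def)
  have M: "norm (M z) \<le> \<epsilon> * norm z" for z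
    using lipschitz_onD[OF lip, of z 0] M0 by (simp add: \<epsilon>_def)
  have "\<omega>-lipschitz_on UNIV (\<lambda>z. - \<i> * of_real \<omega> * z)"
    using \<omega> by (intro lipschitz_onI) (auto simp: dist_norm norm_mult norm_minus_commute simp flip: right_diff_distrib)
  then have lipX: "(\<omega> + \<omega> / 64)-lipschitz_on UNIV X"
    unfolding X_def using lip by (rule lipschitz_on_add)
  from lipschitz_global_solution[OF lipX] obtain z where z0: "z 0 = q"
    and z: "\<And>t. (z has_vector_derivative X (z t)) (at t)"
    by metis
  \<comment> \<open>The rotation part is orthogonal to \<open>z t\<close>, so the growth rate is the
    small constant \<epsilon> of the perturbation.\<close>
  have growth: "norm (z t) \<le> exp (\<epsilon> * \<bar>t\<bar>) * norm q" for t
    unfolding z0[symmetric]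
  proof (rule norm_growth_bound[OF z])
    fix t
    have "inner (z t) (X (z t)) = inner (z t) (M (z t))"
      by (simp add: X_def inner_complex_def algebra_simps)
    also have "\<bar>\<dots>\<bar> \<le> norm (z t) * norm (M (z t))"
      by (rule Cauchy_Schwarz_ineq2)
    also have "\<dots> \<le> norm (z t) * (\<epsilon> * norm (z t))"
      by (intro mult_left_mono M) auto
    finally show "\<bar>inner (z t) (X (z t))\<bar> \<le> \<epsilon> * (norm (z t))\<^sup>2"
      by (simp add: power2_eq_square mult_ac)
  qed
  \<comment> \<open>The window contains the times \<open>\<tau> k\<close> for
    \<open>\<bar>k\<bar> \<le> 3\<close> and one full period \<open>[t1, 2 * t2 - t1]\<close>. On it
    the rate \<open>\<omega> / 64\<close> keeps the exponent below 1/2, and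
    \<open>exp (1 / 2) \<le> 2\<close>.\<close>
  have small: "exp (\<epsilon> * \<bar>t\<bar>) < 2" if "\<bar>t\<bar> \<le> 13 / 2 * pi / \<omega>" for t
  proof -
    have "\<epsilon> * \<bar>t\<bar> \<le> \<epsilon> * (13 / 2 * pi / \<omega>)"
      using \<epsilon> that by (intro mult_left_mono) auto
    also have "\<dots> = 13 / 128 * pi"
      using \<omega> by (simp add: \<epsilon>_def)
    also have "\<dots> < 1 / 2"
      using pi_less_4 by simp
    finally have "exp (\<epsilon> * \<bar>t\<bar>) < exp (1 / 2)"
      by simp
    then show ?thesis
      using exp_half_le2 by linarith
  qed
  \<comment> \<open>In the frame rotating with the linear flow only \<open>M\<close> moves the
    solution, so the drift away from \<open>q\<close> is the integral of the small
    perturbation.\<close>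
  have near: "norm (cis (\<omega> * t) * z t - q) \<le> norm q * (exp (\<epsilon> * \<bar>t\<bar>) - 1)" for t
  proof -
    have "((\<lambda>t. cis (\<omega> * t) * z t) has_vector_derivative cis (\<omega> * t) * M (z t)) (at t)" for t
    proof -
      have "((\<lambda>t. cis (\<omega> * t)) has_vector_derivative \<i> * of_real \<omega> * cis (\<omega> * t)) (at t)"
      proof -
        have "((\<lambda>z. exp (\<i> * of_real \<omega> * z)) has_field_derivative
            \<i> * of_real \<omega> * exp (\<i> * of_real \<omega> * of_real t)) (at (of_real t))"
          by (auto intro!: derivative_eq_intros)
        from has_vector_derivative_real_field[OF this] show ?thesis
          by (simp add: cis_conv_exp mult.assoc)
      qed
      from has_vector_derivative_mult[OF this z[of t]] show ?thesis
        by (simp add: X_def algebra_simps)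
    qed
    moreover have "norm (cis (\<omega> * t) * M (z t)) \<le> \<epsilon> * norm q * exp (\<epsilon> * \<bar>t\<bar>)" for t
      using order_trans[OF M mult_left_mono[OF growth[of t]]] \<epsilon> by (simp add: norm_mult mult_ac)
    ultimately show ?thesis
      using antiderivative_exp_bound[OF \<epsilon>, of "\<lambda>t. cis (\<omega> * t) * z t" "\<lambda>t. cis (\<omega> * t) * M (z t)" "\<epsilon> * norm q" t]
        \<epsilon> z0 by simp
  qed
  define \<delta> where "\<delta> = Arg q"
  have \<delta>: "- pi < \<delta>" "\<delta> \<le> pi"
    by (auto simp: \<delta>_def mpi_less_Arg Arg_le_pi)
  \<comment> \<open>The unperturbed rotation has imaginary part
    \<open>norm q * sin (\<delta> - \<omega> * t)\<close>. An error strictly below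
    \<open>norm q\<close> fixes the sign of \<open>Im (z t)\<close> wherever the sine is 1 or
    -1.\<close>
  have Im_near: "\<bar>Im (z t) - norm q * sin (\<delta> - \<omega> * t)\<bar> < norm q"
    if "\<bar>t\<bar> \<le> 13 / 2 * pi / \<omega>" for t
  proof -
    have "rcis (norm q) (\<delta> - \<omega> * t) = cis (- \<omega> * t) * rcis (norm q) \<delta>"
      using cis_mult[of "- \<omega> * t" \<delta>] by (simp add: rcis_def mult.left_commute)
    then have rot: "rcis (norm q) (\<delta> - \<omega> * t) = cis (- \<omega> * t) * q"
      unfolding \<delta>_def rcis_cmod_Arg .
    have "cis (- \<omega> * t) * (cis (\<omega> * t) * z t) = z t"
      using cis_mult[of "- \<omega> * t" "\<omega> * t"] by (simp only: mult.assoc[symmetric]) simp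
    then have "z t - rcis (norm q) (\<delta> - \<omega> * t) = cis (- \<omega> * t) * (cis (\<omega> * t) * z t - q)"
      by (simp only: rot right_diff_distrib)
    then have "norm (z t - rcis (norm q) (\<delta> - \<omega> * t)) = norm (cis (\<omega> * t) * z t - q)"
      by (simp add: norm_mult)
    also have "\<dots> < norm q"
      using near[of t] small[OF that] q
      by (smt (verit) mult_less_cancel_left2 zero_less_norm_iff)
    finally have "norm (z t - rcis (norm q) (\<delta> - \<omega> * t)) < norm q" .
    then show ?thesis
      using abs_Im_le_cmod[of "z t - rcis (norm q) (\<delta> - \<omega> * t)"] by simp
  qed
  \<comment> \<open>At time \<open>\<tau> k\<close> the unperturbed rotation has argument
    \<open>- k * pi / 2\<close>; the values -1, 1, 3 of \<open>k\<close> give a maximum, a minimum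
    and the next maximum of its imaginary part, hence two crossings of the real axis.\<close>
  define \<tau> where "\<tau> k = (\<delta> + k * pi / 2) / \<omega>" for k
  have \<tau>: "\<omega> * \<tau> k = \<delta> + k * pi / 2" for k
    using \<omega> by (simp add: \<tau>_def)
  have \<tau>_le: "\<bar>\<tau> k\<bar> \<le> 13 / 2 * pi / \<omega>" if "\<bar>k\<bar> \<le> 3" for k
  proof -
    have "\<bar>k * pi / 2\<bar> \<le> 3 * pi / 2"
      using that by (simp add: abs_mult)
    then have "\<bar>\<delta> + k * pi / 2\<bar> \<le> 13 / 2 * pi"
      using \<delta> by linarith
    then show ?thesis
      using \<omega> by (simp add: \<tau>_def field_simps)
  qed
  have "0 < Im (z (\<tau> (- 1)))" "Im (z (\<tau> 1)) < 0" "0 < Im (z (\<tau> 3))"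
    using Im_near[OF \<tau>_le[of "- 1"]] Im_near[OF \<tau>_le[of 1]] Im_near[OF \<tau>_le[of 3]] sin_3over2_pi
    by (auto simp: \<tau>)
  have cont: "continuous_on S (\<lambda>t. Im (z t))" for S
    using z by (intro continuous_intros)
      (meson continuous_at_imp_continuous_on has_vector_derivative_continuous)
  have "\<tau> (- 1) \<le> \<tau> 1" "\<tau> 1 \<le> \<tau> 3"
    using \<omega> by (auto simp: \<tau>_def divide_right_mono)
  obtain t1 where t1: "\<tau> (- 1) \<le> t1" "t1 \<le> \<tau> 1" "Im (z t1) = 0"
    using IVT2'[of "\<lambda>t. Im (z t)" "\<tau> 1" 0 "\<tau> (- 1)"] cont
      \<open>0 < Im (z (\<tau> (- 1)))\<close> \<open>Im (z (\<tau> 1)) < 0\<close> \<open>\<tau> (- 1) \<le> \<tau> 1\<close> by auto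
  obtain t2 where t2: "\<tau> 1 \<le> t2" "t2 \<le> \<tau> 3" "Im (z t2) = 0"
    using IVT'[of "\<lambda>t. Im (z t)" "\<tau> 1" 0 "\<tau> 3"] cont
      \<open>0 < Im (z (\<tau> 3))\<close> \<open>Im (z (\<tau> 1)) < 0\<close> \<open>\<tau> 1 \<le> \<tau> 3\<close> by auto
  have "t1 \<noteq> \<tau> 1"
    using t1 \<open>Im (z (\<tau> 1)) < 0\<close> by auto
  then have "t1 < t2"
    using t1 t2 by linarith
  \<comment> \<open>Conjugation combined with time reflection about \<open>c\<close> maps solutions
    to solutions by \<open>rev\<close>, and it fixes the value at \<open>c\<close> when that value
    is real; uniqueness does the rest.\<close>
  have sym: "z s = cnj (z (2 * c - s))" if "Im (z c) = 0" for c s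
  proof (rule lipschitz_solution_unique[OF lipX z])
    show "z c = cnj (z (2 * c - c))"
      using that by (simp add: complex_eq_iff)
    show "((\<lambda>s. cnj (z (2 * c - s))) has_vector_derivative X (cnj (z (2 * c - s)))) (at s)" for s
      using has_vector_derivative_cnj[OF has_vector_derivative_reflect[OF z, of "2 * c" s]]
      by (simp add: X_def rev)
  qed
  \<comment> \<open>The composition of the reflections about \<open>t1\<close> and \<open>t2\<close>
    is the translation by twice their distance.\<close>
  define T where "T = 2 * (t2 - t1)"
  have per: "z (t + T) = z t" for t
    using sym[OF t2(3), of "t + T"] sym[OF t1(3), of t] by (simp add: T_def algebra_simps)
  have "0 < T"
    using \<open>t1 < t2\<close> by (simp add: T_def)
  show thesis
  proof
    show "0 < T" "z 0 = q" "z (t + T) = z t" for t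
      by fact+
    show "(z has_vector_derivative - \<i> * of_real \<omega> * z t + M (z t)) (at t)" for t
      using z by (simp add: X_def)
    show "\<exists>t. z t \<noteq> q"
      using \<open>0 < Im (z (\<tau> (- 1)))\<close> \<open>Im (z (\<tau> 1)) < 0\<close> less_asym by metis
    fix t
    \<comment> \<open>Subtracting \<open>n\<close> periods moves \<open>t\<close> into
      \<open>[t1, t1 + T]\<close>, which lies in the window where the growth factor stays below
      2.\<close>
    define n where "n = \<lfloor>(t - t1) / T\<rfloor>"
    interpret periodic_fun_simple z T
      by standard (rule per)
    have "of_int n * T \<le> t - t1" "t - t1 \<le> (of_int n + 1) * T"
      using \<open>0 < T\<close> floor_divide_lower[of T "t - t1"] floor_divide_upper[of T "t - t1"]
      by (auto simp: n_def)
    then have "t1 \<le> t - of_int n * T" "t - of_int n * T \<le> 2 * t2 - t1"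
      by (auto simp: T_def algebra_simps)
    moreover have "2 * t2 - t1 \<le> 13 / 2 * pi / \<omega>"
    proof -
      have "2 * t2 - t1 \<le> 2 * \<tau> 3 - \<tau> (- 1)"
        using t1 t2 by linarith
      also have "\<dots> = (\<delta> + 7 / 2 * pi) / \<omega>"
        by (simp add: \<tau>_def add_divide_distrib diff_divide_distrib)
      also have "\<dots> \<le> 13 / 2 * pi / \<omega>"
        using \<omega> \<delta> by (intro divide_right_mono) auto
      finally show ?thesis .
    qed
    moreover have "- (13 / 2 * pi / \<omega>) \<le> t1"
      using \<tau>_le[of "- 1"] t1(1) by linarith
    ultimately have "exp (\<epsilon> * \<bar>t - of_int n * T\<bar>) < 2"
      by (intro small) linarith
    then have "exp (\<epsilon> * \<bar>t - of_int n * T\<bar>) * norm q \<le> 2 * norm q"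
      by (intro mult_right_mono) auto
    with growth[of "t - of_int n * T"] show "norm (z t) \<le> 2 * norm q"
      by (simp add: minus_of_int)
  qed
qed

text \<open>All terms of \<open>N\<close> have degree at least 2, so on a box of half-width \<rho>
  its difference quotients are of order \<rho>. Clamping each coordinate does not increase
  distances, which carries the small constant over to the whole plane.\<close>

lemma clamped_cubic_lipschitz:
  fixes \<alpha> \<beta> \<kappa> \<epsilon> :: real
  assumes \<epsilon>: "0 < \<epsilon>"
  defines "N \<equiv> \<lambda>y u. \<alpha> * y\<^sup>2 + \<beta> * y ^ 3 + \<kappa> * y * u"
  obtains \<rho> where "0 < \<rho>"
    "\<And>y u y' u'. \<bar>N (max (- \<rho>) (min \<rho> y)) (max (- \<rho>) (min \<rho> u))
      - N (max (- \<rho>) (min \<rho> y')) (max (- \<rho>) (min \<rho> u'))\<bar> \<le> \<epsilon> * (\<bar>y - y'\<bar> + \<bar>u - u'\<bar>)"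
proof -
  \<comment> \<open>The coefficients count the factors in the factored difference of
    \<open>N\<close>: two for the square, three for the cube, one for the mixed term. The summand 1
    allows division by \<open>C\<close>; \<open>\<rho> \<le> 1\<close> lets products of two
    coordinates be bounded by \<rho>.\<close>
  define C where "C = 2 * \<bar>\<alpha>\<bar> + 3 * \<bar>\<beta>\<bar> + \<bar>\<kappa>\<bar> + 1"
  have C: "0 < C"
    by (simp add: C_def)
  define \<rho> where "\<rho> = min 1 (\<epsilon> / C)"
  have \<rho>: "0 < \<rho>" "\<rho> \<le> 1" "\<rho> * C \<le> \<epsilon>"
    using \<epsilon> C by (auto simp: \<rho>_def min_def field_simps)
  have box: "\<bar>N y u - N y' u'\<bar> \<le> \<epsilon> * (\<bar>y - y'\<bar> + \<bar>u - u'\<bar>)"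
    if "\<bar>y\<bar> \<le> \<rho>" "\<bar>u\<bar> \<le> \<rho>" "\<bar>y'\<bar> \<le> \<rho>" "\<bar>u'\<bar> \<le> \<rho>" for y u y' u'
  proof -
    have "N y u - N y' u' = (\<alpha> * (y + y') + \<beta> * (y * y + y * y' + y' * y') + \<kappa> * u) * (y - y')
        + \<kappa> * y' * (u - u')"
      by (simp add: N_def algebra_simps power2_eq_square power3_eq_cube)
    also have "\<bar>\<dots>\<bar> \<le> \<epsilon> * \<bar>y - y'\<bar> + \<epsilon> * \<bar>u - u'\<bar>"
    proof (rule order_trans[OF abs_triangle_ineq], unfold abs_mult, intro add_mono mult_right_mono)
      have prod: "\<bar>s * t\<bar> \<le> \<rho>" if "\<bar>s\<bar> \<le> \<rho>" "\<bar>t\<bar> \<le> \<rho>" for s t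
        using mult_mono[of "\<bar>s\<bar>" \<rho> "\<bar>t\<bar>" 1] that \<rho> by (simp add: abs_mult)
      have le: "\<bar>\<alpha> * (y + y') + \<beta> * (y * y + y * y' + y' * y') + \<kappa> * u\<bar>
          \<le> \<bar>\<alpha>\<bar> * \<bar>y + y'\<bar> + \<bar>\<beta>\<bar> * \<bar>y * y + y * y' + y' * y'\<bar> + \<bar>\<kappa>\<bar> * \<bar>u\<bar>"
        unfolding abs_mult[symmetric] by linarith
      have "\<bar>y * y + y * y' + y' * y'\<bar> \<le> 3 * \<rho>"
        using that prod[of y y] prod[of y y'] prod[of y' y'] by linarith
      then have "\<bar>\<alpha>\<bar> * \<bar>y + y'\<bar> + \<bar>\<beta>\<bar> * \<bar>y * y + y * y' + y' * y'\<bar> + \<bar>\<kappa>\<bar> * \<bar>u\<bar>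
          \<le> \<bar>\<alpha>\<bar> * (2 * \<rho>) + \<bar>\<beta>\<bar> * (3 * \<rho>) + \<bar>\<kappa>\<bar> * \<rho>"
        using that by (intro add_mono mult_left_mono) auto
      also have "\<dots> \<le> \<rho> * C"
        using \<rho> by (simp add: C_def algebra_simps)
      finally show "\<bar>\<alpha> * (y + y') + \<beta> * (y * y + y * y' + y' * y') + \<kappa> * u\<bar> \<le> \<epsilon>"
        using le \<rho> by linarith
      have "\<bar>\<kappa>\<bar> * \<bar>y'\<bar> \<le> C * \<rho>"
        using that by (intro mult_mono) (auto simp: C_def)
      then show "\<bar>\<kappa>\<bar> * \<bar>y'\<bar> \<le> \<epsilon>"
        using \<rho> by (simp add: mult.commute)
    qed auto
    finally show ?thesis
      by (simp add: distrib_left)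
  qed
  show thesis
  proof (rule that[OF \<rho>(1)])
    fix y u y' u' :: real
    let ?c = "\<lambda>x. max (- \<rho>) (min \<rho> x)"
    have "\<bar>?c x\<bar> \<le> \<rho>" for x
      using \<rho> by (auto simp: max_def min_def)
    then have "\<bar>N (?c y) (?c u) - N (?c y') (?c u')\<bar>
        \<le> \<epsilon> * (\<bar>?c y - ?c y'\<bar> + \<bar>?c u - ?c u'\<bar>)"
      by (intro box)
    also have "\<dots> \<le> \<epsilon> * (\<bar>y - y'\<bar> + \<bar>u - u'\<bar>)"
      using \<epsilon> by (intro mult_left_mono add_mono) (auto simp: max_def min_def)
    finally show "\<bar>N (?c y) (?c u) - N (?c y') (?c u')\<bar> \<le> \<epsilon> * (\<bar>y - y'\<bar> + \<bar>u - u'\<bar>)" .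
  qed
qed

text \<open>Clamping the nonlinearity to a small box makes it globally Lipschitz with a small constant; the
  orbits that start close enough to the origin never leave the box. The complex coordinate is
  \<open>y + \<i> u\<close> or \<open>\<i> (y + \<i> u)\<close>, so that the reversing symmetry is always complex conjugation.\<close>
theorem reversible_lienard_periodic:
  fixes \<omega> \<alpha> \<beta> \<kappa> :: real
  assumes \<omega>: "0 < \<omega>" and "\<alpha> = 0 \<or> \<kappa> = 0"
  obtains r where "0 < r"
    "\<And>y0 u0. \<lbrakk>(y0, u0) \<noteq> (0, 0); norm (y0, u0) < r\<rbrakk> \<Longrightarrow> \<exists>y u T. 0 < T \<and> y 0 = y0 \<and> u 0 = u0 \<and>
      (\<forall>t. (y has_real_derivative \<omega> * u t) (at t)) \<and>
      (\<forall>t. (u has_real_derivative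
         - \<omega> * y t + (\<alpha> * (y t)\<^sup>2 + \<beta> * y t ^ 3 + \<kappa> * y t * u t)) (at t)) \<and>
      (\<forall>t. y (t + T) = y t \<and> u (t + T) = u t) \<and> (\<exists>t. (y t, u t) \<noteq> (y0, u0))"
proof -
  let ?N = "\<lambda>y u. \<alpha> * y\<^sup>2 + \<beta> * y ^ 3 + \<kappa> * y * u"
  \<comment> \<open>Half of \<open>\<omega> / 64\<close>, because the sum of the two coordinate
    differences is at most twice the complex distance.\<close>
  have "0 < \<omega> / 128"
    using \<omega> by simp
  then obtain \<rho> where \<rho>: "0 < \<rho>"
    and lip: "\<And>y u y' u'. \<bar>?N (max (- \<rho>) (min \<rho> y)) (max (- \<rho>) (min \<rho> u))
      - ?N (max (- \<rho>) (min \<rho> y')) (max (- \<rho>) (min \<rho> u'))\<bar> \<le> \<omega> / 128 * (\<bar>y - y'\<bar> + \<bar>u - u'\<bar>)"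
    using clamped_cubic_lipschitz[of "\<omega> / 128" \<alpha> \<beta> \<kappa>] by metis
  define c where "c = (\<lambda>x. max (- \<rho>) (min \<rho> x))"
  have c: "c x = x" if "\<bar>x\<bar> \<le> \<rho>" for x
    using that by (auto simp: c_def)
  have c_minus: "c (- x) = - c x" for x
    using \<rho> by (auto simp: c_def max_def min_def)
  have c0: "c 0 = 0"
    using c[of 0] \<rho> by simp
  have Re_Im: "\<omega> / 128 * (\<bar>Re z - Re z'\<bar> + \<bar>Im z - Im z'\<bar>) \<le> \<omega> / 64 * dist z z'" for z z'
    using mult_left_mono[of "\<bar>Re z - Re z'\<bar> + \<bar>Im z - Im z'\<bar>" "2 * dist z z'" "\<omega> / 128"]
      abs_Re_le_cmod[of "z - z'"] abs_Im_le_cmod[of "z - z'"] \<omega> by (simp add: dist_norm)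
  have small: "\<bar>Re z\<bar> \<le> \<rho>" "\<bar>Im z\<bar> \<le> \<rho>" if "norm z \<le> 2 * norm q" "norm q < \<rho> / 2" for z q :: complex
    using that abs_Re_le_cmod[of z] abs_Im_le_cmod[of z] by linarith+
  have Re_deriv: "((\<lambda>t. Re (z t)) has_real_derivative Re z') (at t)"
    and Im_deriv: "((\<lambda>t. Im (z t)) has_real_derivative Im z') (at t)"
    if "(z has_vector_derivative z') (at t)" for z z' t
    using that unfolding has_real_derivative_iff_has_vector_derivative
    by (auto intro: bounded_linear.has_vector_derivative bounded_linear_Re bounded_linear_Im)
  \<comment> \<open>Orbits at most double their initial norm, so starting within
    \<open>\<rho> / 2\<close> keeps them in the box where clamping is the identity.\<close>
  show thesis
  proof (rule that[of "\<rho> / 2"])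
    fix y0 u0 :: real
    assume nz: "(y0, u0) \<noteq> (0, 0)" and lt: "norm (y0, u0) < \<rho> / 2"
    consider "\<kappa> = 0" | "\<alpha> = 0"
      using assms by auto
    then show "\<exists>y u T. 0 < T \<and> y 0 = y0 \<and> u 0 = u0 \<and>
      (\<forall>t. (y has_real_derivative \<omega> * u t) (at t)) \<and>
      (\<forall>t. (u has_real_derivative - \<omega> * y t + ?N (y t) (u t)) (at t)) \<and>
      (\<forall>t. y (t + T) = y t \<and> u (t + T) = u t) \<and> (\<exists>t. (y t, u t) \<noteq> (y0, u0))"
    proof cases
      case 1
      define q where "q = Complex y0 u0"
      \<comment> \<open>With \<open>\<kappa> = 0\<close> the nonlinearity depends on
        \<open>y = Re z\<close> alone, so it is unchanged by conjugation; the factor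
        \<open>\<i>\<close> puts it into the equation for \<open>u = Im z\<close>.\<close>
      define M where "M z = \<i> * of_real (?N (c (Re z)) (c (Im z)))" for z
      have q: "q \<noteq> 0" "norm q < \<rho> / 2"
        using nz lt by (auto simp: q_def complex_eq_iff norm_Pair cmod_def)
      have "(\<omega> / 64)-lipschitz_on UNIV M"
      proof (rule lipschitz_onI)
        fix z z'
        have "dist (M z) (M z') = \<bar>?N (c (Re z)) (c (Im z)) - ?N (c (Re z')) (c (Im z'))\<bar>"
          unfolding M_def dist_norm right_diff_distrib[symmetric] of_real_diff[symmetric] norm_mult
          by (simp only: norm_ii norm_of_real mult_1_left)
        also have "\<dots> \<le> \<omega> / 64 * dist z z'"
          unfolding c_def by (rule order_trans[OF lip Re_Im])
        finally show "dist (M z) (M z') \<le> \<omega> / 64 * dist z z'" .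
      qed (use \<omega> in simp)
      moreover have "M 0 = 0"
        by (simp add: M_def c0)
      moreover have "M (cnj z) = - cnj (M z)" for z
        by (simp add: M_def 1)
      ultimately obtain z T where T: "0 < T" and z0: "z 0 = q"
        and z: "\<And>t. (z has_vector_derivative - \<i> * of_real \<omega> * z t + M (z t)) (at t)"
        and per: "\<And>t. z (t + T) = z t" and nc: "\<exists>t. z t \<noteq> q"
        and bound: "\<And>t. norm (z t) \<le> 2 * norm q"
        using reversible_rotation_periodic[OF \<omega> _ _ _ q(1)] by metis
      have cz: "c (Re (z t)) = Re (z t)" "c (Im (z t)) = Im (z t)" for t
        using small[OF bound q(2)] by (auto intro: c)
      have "((\<lambda>t. Re (z t)) has_real_derivative \<omega> * Im (z t)) (at t)"
        "((\<lambda>t. Im (z t)) has_real_derivative - \<omega> * Re (z t) + ?N (Re (z t)) (Im (z t))) (at t)" for t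
        using Re_deriv[OF z, of t] Im_deriv[OF z, of t] by (simp_all add: M_def cz)
      moreover have "\<exists>t. (Re (z t), Im (z t)) \<noteq> (y0, u0)"
        using nc by (auto simp: q_def complex_eq_iff)
      ultimately show ?thesis
        using T per z0 by (intro exI[of _ "\<lambda>t. Re (z t)"] exI[of _ "\<lambda>t. Im (z t)"] exI[of _ T])
          (simp add: q_def)
    next
      case 2
      define q where "q = Complex (- u0) y0"
      \<comment> \<open>Here \<open>z = - u + \<i> * y\<close>, so conjugation is
        \<open>y \<mapsto> - y\<close>, under which the nonlinearity is odd because
        \<open>\<alpha> = 0\<close>.\<close>
      define M where "M z = - complex_of_real (?N (c (Im z)) (c (- Re z)))" for z
      have q: "q \<noteq> 0" "norm q < \<rho> / 2"
        using nz lt by (auto simp: q_def complex_eq_iff norm_Pair cmod_def add.commute)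
      have "(\<omega> / 64)-lipschitz_on UNIV M"
      proof (rule lipschitz_onI)
        fix z z'
        have "dist (M z) (M z') = \<bar>?N (c (Im z)) (c (- Re z)) - ?N (c (Im z')) (c (- Re z'))\<bar>"
          unfolding M_def dist_minus dist_of_real dist_real_def ..
        also have "\<dots> \<le> \<omega> / 128 * (\<bar>Im z - Im z'\<bar> + \<bar>- Re z - - Re z'\<bar>)"
          unfolding c_def by (rule lip)
        also have "\<dots> \<le> \<omega> / 64 * dist z z'"
          using Re_Im[of z z'] by (simp add: add.commute abs_minus_commute)
        finally show "dist (M z) (M z') \<le> \<omega> / 64 * dist z z'" .
      qed (use \<omega> in simp)
      moreover have "M 0 = 0"
        by (simp add: M_def c0)
      moreover have "M (cnj z) = - cnj (M z)" for z
        by (simp add: M_def 2 c_minus)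
      ultimately obtain z T where T: "0 < T" and z0: "z 0 = q"
        and z: "\<And>t. (z has_vector_derivative - \<i> * of_real \<omega> * z t + M (z t)) (at t)"
        and per: "\<And>t. z (t + T) = z t" and nc: "\<exists>t. z t \<noteq> q"
        and bound: "\<And>t. norm (z t) \<le> 2 * norm q"
        using reversible_rotation_periodic[OF \<omega> _ _ _ q(1)] by metis
      have cz: "c (Re (z t)) = Re (z t)" "c (Im (z t)) = Im (z t)" for t
        using small[OF bound q(2)] by (auto intro: c)
      have "((\<lambda>t. Im (z t)) has_real_derivative \<omega> * (- Re (z t))) (at t)"
        "((\<lambda>t. - Re (z t)) has_real_derivative - \<omega> * Im (z t) + ?N (Im (z t)) (- Re (z t))) (at t)" for t
        using DERIV_minus[OF Re_deriv[OF z, of t]] Im_deriv[OF z, of t]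
        by (simp_all add: M_def cz c_minus 2)
      moreover have "\<exists>t. (Im (z t), - Re (z t)) \<noteq> (y0, u0)"
        using nc by (auto simp: q_def complex_eq_iff)
      ultimately show ?thesis
        using T per z0 by (intro exI[of _ "\<lambda>t. Im (z t)"] exI[of _ "\<lambda>t. - Re (z t)"] exI[of _ T])
          (simp add: q_def)
    qed
  qed (use \<rho> in simp)
qed

text \<open>Measuring the velocity \<open>y'\<close> in units of \<omega>, the root of the
  determinant, turns the linear part into a rotation. The Lienard system becomes the one treated
  above, with \<alpha> and \<beta> the coefficients of \<open>- g / \<omega>\<close> and \<kappa>
  equal to \<open>a1 - 2 * b2\<close>.\<close>

lemma cubic_system_closed_orbits:
  fixes a a1 b2 c1 c2 c3 :: real
  defines "F \<equiv> \<lambda>(\<xi>, y). (c1 * y + c2 * y\<^sup>2 + c3 * y ^ 3 + (a + a1 * y) * \<xi>, - \<xi> - (a * y + b2 * y\<^sup>2))"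
  assumes pos: "0 < c1 - a * a"
    and cases: "a1 - 2 * b2 = 0 \<or> c2 - a * (a1 + b2) = 0"
  obtains r where "0 < r" "\<And>p. \<lbrakk>0 < norm p; norm p < r\<rbrakk> \<Longrightarrow> closed_orbit_through F p"
proof -
  define \<omega> where "\<omega> = sqrt (c1 - a * a)"
  have \<omega>: "0 < \<omega>" "c1 = \<omega>\<^sup>2 + a * a"
    using pos by (auto simp: \<omega>_def)
  define \<alpha> where "\<alpha> = - (c2 - a * (a1 + b2)) / \<omega>"
  define \<beta> where "\<beta> = - (c3 - a1 * b2) / \<omega>"
  have c2: "c2 = a * (a1 + b2) - \<omega> * \<alpha>" and c3: "c3 = a1 * b2 - \<omega> * \<beta>"
    using \<omega> by (auto simp: \<alpha>_def \<beta>_def)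
  have "\<alpha> = 0 \<or> a1 - 2 * b2 = 0"
    using cases by (auto simp: \<alpha>_def)
  from reversible_lienard_periodic[OF \<omega>(1) this] obtain r where r: "0 < r"
    and orbit: "\<And>y0 u0. \<lbrakk>(y0, u0) \<noteq> (0, 0); norm (y0, u0) < r\<rbrakk> \<Longrightarrow> \<exists>y u T. 0 < T \<and> y 0 = y0 \<and> u 0 = u0 \<and>
      (\<forall>t. (y has_real_derivative \<omega> * u t) (at t)) \<and>
      (\<forall>t. (u has_real_derivative
         - \<omega> * y t + (\<alpha> * (y t)\<^sup>2 + \<beta> * y t ^ 3 + (a1 - 2 * b2) * y t * u t)) (at t)) \<and>
      (\<forall>t. y (t + T) = y t \<and> u (t + T) = u t) \<and> (\<exists>t. (y t, u t) \<noteq> (y0, u0))"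
    by metis
  \<comment> \<open>The coordinate change from \<open>(\<xi>, y)\<close> to
    \<open>(y, y' / \<omega>)\<close>. Its continuity at the origin converts the radius
    \<open>r\<close> into one for the original system; \<open>x\<close> below inverts it along an
    orbit.\<close>
  define \<Phi> where "\<Phi> p = (snd p, (- fst p - a * snd p - b2 * (snd p)\<^sup>2) / \<omega>)" for p :: "real \<times> real"
  have "isCont \<Phi> 0"
    unfolding \<Phi>_def using \<omega> by (intro continuous_intros) auto
  then obtain d where d: "0 < d" "\<And>p. norm p < d \<Longrightarrow> norm (\<Phi> p) < r"
    using r unfolding continuous_at_eps_delta by (auto simp: \<Phi>_def dist_norm zero_prod_def[symmetric])
  show thesis
  proof (rule that[OF d(1)])
    fix p :: "real \<times> real"
    assume p: "0 < norm p" "norm p < d"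
    obtain \<xi>0 y0 where p_eq: "p = (\<xi>0, y0)"
      by (cases p)
    have "\<Phi> p \<noteq> (0, 0)"
      using p \<omega> by (auto simp: \<Phi>_def p_eq zero_prod_def)
    with d(2)[OF p(2)] orbit[of "fst (\<Phi> p)" "snd (\<Phi> p)"]
    obtain y u T where T: "0 < T" and init: "y 0 = fst (\<Phi> p)" "u 0 = snd (\<Phi> p)"
      and y: "\<And>t. (y has_real_derivative \<omega> * u t) (at t)"
      and u: "\<And>t. (u has_real_derivative
         - \<omega> * y t + (\<alpha> * (y t)\<^sup>2 + \<beta> * y t ^ 3 + (a1 - 2 * b2) * y t * u t)) (at t)"
      and per: "\<And>t. y (t + T) = y t \<and> u (t + T) = u t"
      and nc: "\<exists>t. (y t, u t) \<noteq> (fst (\<Phi> p), snd (\<Phi> p))"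
      by auto
    define x where "x t = (- \<omega> * u t - a * y t - b2 * (y t)\<^sup>2, y t)" for t
    obtain t where t: "(y t, u t) \<noteq> (fst (\<Phi> p), snd (\<Phi> p))"
      using nc by auto
    show "closed_orbit_through F p"
      unfolding closed_orbit_through_def
    proof (intro exI conjI allI)
      show "0 < T"
        by fact
      show "x 0 = p"
        using \<omega> by (simp add: x_def init \<Phi>_def p_eq)
      show "x (t + T) = x t" for t
        by (simp add: x_def per)
      show "(x has_vector_derivative F (x t)) (at t)" for t
      proof -
        have "((\<lambda>t. - \<omega> * u t - a * y t - b2 * (y t)\<^sup>2) has_real_derivative fst (F (x t))) (at t)"
          by (rule derivative_eq_intros y u refl)+
            (simp add: F_def x_def c2 c3 \<omega>(2) algebra_simps power2_eq_square power3_eq_cube)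
        moreover have "(y has_real_derivative snd (F (x t))) (at t)"
          using y by (simp add: F_def x_def)
        ultimately have "((\<lambda>t. (- \<omega> * u t - a * y t - b2 * (y t)\<^sup>2, y t)) has_vector_derivative
            (fst (F (x t)), snd (F (x t)))) (at t)"
          unfolding has_real_derivative_iff_has_vector_derivative by (rule has_vector_derivative_Pair)
        then show ?thesis
          unfolding x_def by simp
      qed
      show "x t \<noteq> p"
        using t \<omega> by (auto simp: x_def p_eq \<Phi>_def field_simps)
    qed
  qed
qed

section \<open>The focus case\<close>

text \<open>Before the orbit first reaches the sphere of radius \<rho>, \<open>V\<close> cannot
  increase, so it cannot climb to the level \<open>m\<close> required there. The orbit is therefore
  trapped, \<open>V\<close> never increases at later times, and its strict initial drop excludes a
  return to \<open>x 0\<close>.\<close>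

lemma lyapunov_not_periodic:
  fixes x :: "real \<Rightarrow> 'a::real_normed_vector" and V :: "'a \<Rightarrow> real"
  assumes cont: "continuous_on UNIV x"
    and periodic: "0 < T" "x T = x 0"
    and start: "norm (x 0) < \<rho>" "V (x 0) < m"
    and barrier: "\<And>p. norm p = \<rho> \<Longrightarrow> m \<le> V p"
    and deriv: "\<And>t. ((\<lambda>t. V (x t)) has_real_derivative D t) (at t)"
    and le: "\<And>t. norm (x t) \<le> \<rho> \<Longrightarrow> D t \<le> 0"
    and less: "D 0 < 0"
  shows False
proof -
  have decr: "V (x b) \<le> V (x a)" if "a \<le> b" and "\<And>t. \<lbrakk>a \<le> t; t \<le> b\<rbrakk> \<Longrightarrow> norm (x t) \<le> \<rho>" for a b
    using DERIV_nonpos_imp_nonincreasing[of a b "\<lambda>t. V (x t)"] that deriv le by blast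
  have trapped: "norm (x t) \<le> \<rho>" if "0 \<le> t" for t
  proof (rule ccontr)
    assume "\<not> norm (x t) \<le> \<rho>"
    \<comment> \<open>Compactness of \<open>S\<close> provides the first time at which the orbit is
      not strictly inside the ball.\<close>
    define S where "S = {0..t} \<inter> (\<lambda>s. norm (x s)) -` {\<rho>..}"
    have "closed S"
      unfolding S_def using cont
      by (intro continuous_closed_preimage continuous_intros) (auto intro: continuous_on_subset)
    then have "compact S"
      by (auto intro: compact_Int_closed bounded_subset[of "{0..t}"] simp: S_def compact_eq_bounded_closed)
    moreover have "t \<in> S"
      using \<open>\<not> norm (x t) \<le> \<rho>\<close> that by (auto simp: S_def)
    ultimately obtain s where s: "s \<in> S" and min: "\<And>r. r \<in> S \<Longrightarrow> s \<le> r"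
      using compact_attains_inf[of S] by blast
    have inside: "norm (x r) < \<rho>" if "0 \<le> r" "r < s" for r
      using min[of r] that s by (force simp: S_def)
    have "norm (x s) = \<rho>"
    proof (rule ccontr)
      assume "norm (x s) \<noteq> \<rho>"
      then have "\<rho> < norm (x s)" "0 \<le> s"
        using s by (auto simp: S_def)
      then obtain r where "0 \<le> r" "r \<le> s" "norm (x r) = \<rho>"
        using IVT'[of "\<lambda>r. norm (x r)" 0 \<rho> s] start(1) cont
        by (auto intro: continuous_intros continuous_on_subset)
      then show False
        using inside[of r] \<open>norm (x s) \<noteq> \<rho>\<close> by (cases "r = s") auto
    qed
    moreover have "V (x s) \<le> V (x 0)"
      using s inside calculation by (intro decr) (auto simp: S_def less_le)
    ultimately show False
      using barrier[of "x s"] start(2) by linarith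
  qed
  obtain d where d: "0 < d" "\<And>h. \<lbrakk>0 < h; h < d\<rbrakk> \<Longrightarrow> V (x (0 + h)) < V (x 0)"
    using DERIV_neg_dec_right[OF deriv less] by blast
  \<comment> \<open>A time in the interval of strict initial decrease that does not exceed
    \<open>T\<close>; from \<open>h\<close> to \<open>T\<close> weak decrease suffices.\<close>
  define h where "h = min (d / 2) T"
  have h: "0 < h" "h < d" "h \<le> T"
    using d periodic by (auto simp: h_def)
  have "V (x T) \<le> V (x h)"
    using h trapped by (intro decr) auto
  also have "\<dots> < V (x 0)"
    using d(2)[of h] h by simp
  finally show False
    using periodic by simp
qed

text \<open>The differentiated function is the energy \<open>z\<^sup>2/2 + \<integral>(w y + g y\<^sup>2 + h y\<^sup>3)\<close> with cubic and quartic
  corrections, chosen so that the lowest-order part of its derivative is the definite form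
  \<open>- e (w y\<^sup>4/12 + y\<^sup>2 z\<^sup>2/2 + z\<^sup>4/(12 w))\<close>. Everything of higher order is divisible by \<open>y\<^sup>4\<close> or
  \<open>y\<^sup>2 z\<^sup>2\<close>, hence is absorbed near the origin.\<close>
lemma lienard_lyapunov_derivative:
  fixes y z :: "real \<Rightarrow> real"
  assumes w: "0 < w"
    and y: "(y has_real_derivative z t + k / 2 * (y t)\<^sup>2) (at t)"
    and z: "(z has_real_derivative - (w * y t + g * (y t)\<^sup>2 + h * y t ^ 3)) (at t)"
  defines "e \<equiv> k * g / w"
  shows "((\<lambda>t. (y t)\<^sup>2 * (w / 2 + g * y t / 3 + h * (y t)\<^sup>2 / 4 + k / 2 * z t - k\<^sup>2 * (y t)\<^sup>2 / 8
        + e * y t * z t / 12)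
      + (z t)\<^sup>2 * (1 / 2 + k * z t / (3 * w) - e * y t * z t / (12 * w)))
    has_real_derivative
    - ((e * w / 12 + k ^ 3 / 4 * y t - e / 12 * (3 * k / 2 * z t - g * y t - h * (y t)\<^sup>2)) * y t ^ 4
      + (e / 2 + k * h / w * y t + e / (12 * w) * (k / 2 * z t - 3 * g * y t - 3 * h * (y t)\<^sup>2))
        * (y t)\<^sup>2 * (z t)\<^sup>2
      + e / (12 * w) * z t ^ 4)) (at t)"
    (is "(?V has_real_derivative ?D) (at t)")
proof -
  \<comment> \<open>The partial derivatives of the Lyapunov function. Its terms
    \<open>k / 2 * y^2 * z\<close> and \<open>k * z^3 / (3 * w)\<close> cancel the cubic part of the
    derivative of the energy, and \<open>- k^2 * y^4 / 8\<close> cancels the term in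
    \<open>y^3 * z\<close>. What remains in degree four is \<open>- e * y^2 * z^2\<close>; the two
    terms with \<open>e / 12\<close> spread this semidefinite form into a definite one.\<close>
  let ?Vy = "w * y t + g * (y t)\<^sup>2 + h * y t ^ 3 + k * y t * z t - k\<^sup>2 / 2 * y t ^ 3
    + e * (y t)\<^sup>2 * z t / 4 - e * z t ^ 3 / (12 * w)"
  let ?Vz = "z t + k / 2 * (y t)\<^sup>2 + k * (z t)\<^sup>2 / w + e * y t ^ 3 / 12 - e * y t * (z t)\<^sup>2 / (4 * w)"
  let ?Y = "z t + k / 2 * (y t)\<^sup>2" and ?Z = "- (w * y t + g * (y t)\<^sup>2 + h * y t ^ 3)"
  have chain: "(?V has_real_derivative ?Vy * Y + ?Vz * Z) (at t)"
    if "(y has_real_derivative Y) (at t)" "(z has_real_derivative Z) (at t)" for Y Z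
    using w by (auto intro!: derivative_eq_intros that simp: field_simps power_numeral_reduce)
  \<comment> \<open>Writing \<open>g\<close> and \<open>h\<close> as multiples of powers of
    \<open>w\<close> clears every division by \<open>w\<close>, so that the claim becomes a
    polynomial identity.\<close>
  define d n where "d = g / w / w" and "n = h / w"
  have g: "g = w * (w * d)" and h: "h = w * n" and e: "e = k * (w * d)"
    using w by (simp_all add: d_def n_def e_def)
  have cancel: "e * x / (12 * w) = k * d * x / 12" "e * x / (4 * w) = k * d * x / 4"
    "k * h / w = k * n" "e / (12 * w) = k * d / 12" for x
    using w by (simp_all add: e h)
  have cancel': "k * (z t)\<^sup>2 / w * (w * y t + g * (y t)\<^sup>2 + h * y t ^ 3)
      = k * (z t)\<^sup>2 * (y t + w * d * (y t)\<^sup>2 + n * y t ^ 3)"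
    using w by (simp add: g h field_simps)
  have "(w * y t + g * (y t)\<^sup>2 + h * y t ^ 3 + k * y t * z t - k\<^sup>2 / 2 * y t ^ 3 + e * (y t)\<^sup>2 * z t / 4
        - k * d * z t ^ 3 / 12) * ?Y
      - ((z t + k / 2 * (y t)\<^sup>2 + e * y t ^ 3 / 12 - k * d * (y t * (z t)\<^sup>2) / 4)
        * (w * y t + g * (y t)\<^sup>2 + h * y t ^ 3) + k * (z t)\<^sup>2 * (y t + w * d * (y t)\<^sup>2 + n * y t ^ 3))
    = - ((e * w / 12 + k ^ 3 / 4 * y t - e / 12 * (3 * k / 2 * z t - g * y t - h * (y t)\<^sup>2)) * y t ^ 4
      + (e / 2 + k * n * y t + k * d / 12 * (k / 2 * z t - 3 * g * y t - 3 * h * (y t)\<^sup>2))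
        * (y t)\<^sup>2 * (z t)\<^sup>2
      + k * d / 12 * z t ^ 4)"
    unfolding e g h by (simp add: field_simps power_numeral_reduce)
  then have "?Vy * ?Y + ?Vz * ?Z = ?D"
    unfolding cancel'[symmetric] mult.assoc[of e] cancel by (simp add: algebra_simps)
  with chain[OF y z] show ?thesis
    by (simp only:)
qed

text \<open>For \<open>k * g > 0\<close> the constant \<open>e\<close> is positive, so the quartic
  Lyapunov function decreases strictly along nonzero orbits near the origin, and the trapping
  argument applies in forward time.\<close>

lemma lienard_focus_pos:
  fixes w g h k :: real
  assumes w: "0 < w" and kg: "0 < k * g"
  shows "\<exists>r>0. \<forall>y z T.
      (\<forall>t. (y has_real_derivative z t + k / 2 * (y t)\<^sup>2) (at t)) \<longrightarrow>
      (\<forall>t. (z has_real_derivative - (w * y t + g * (y t)\<^sup>2 + h * y t ^ 3)) (at t)) \<longrightarrow>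
      0 < norm (y 0, z 0) \<longrightarrow> norm (y 0, z 0) < r \<longrightarrow> 0 < T \<longrightarrow> (y T, z T) \<noteq> (y 0, z 0)"
proof -
  define e where "e = k * g / w"
  have e: "0 < e" "k * g = e * w"
    using w kg by (auto simp: e_def)
  \<comment> \<open>\<open>V1\<close> and \<open>V2\<close> are the cofactors of the squares in
    \<open>V\<close>; \<open>D1\<close> and \<open>D2\<close> are the cofactors of
    \<open>y^4\<close> and \<open>y^2 * z^2\<close> in minus its derivative. All four are continuous
    and positive at 0, so definiteness near the origin reduces to continuity.\<close>
  define V1 where "V1 p = w / 2 + g * fst p / 3 + h * (fst p)\<^sup>2 / 4 + k / 2 * snd p
    - k\<^sup>2 * (fst p)\<^sup>2 / 8 + e * fst p * snd p / 12" for p :: "real \<times> real"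
  define V2 where "V2 p = 1 / 2 + k * snd p / (3 * w) - e * fst p * snd p / (12 * w)"
    for p :: "real \<times> real"
  define V where "V p = (fst p)\<^sup>2 * V1 p + (snd p)\<^sup>2 * V2 p" for p
  define D1 where "D1 p = e * w / 12 + k ^ 3 / 4 * fst p
    - e / 12 * (3 * k / 2 * snd p - g * fst p - h * (fst p)\<^sup>2)" for p :: "real \<times> real"
  define D2 where "D2 p = e / 2 + k * h / w * fst p
    + e / (12 * w) * (k / 2 * snd p - 3 * g * fst p - 3 * h * (fst p)\<^sup>2)" for p :: "real \<times> real"
  define D where "D p = - (D1 p * fst p ^ 4 + D2 p * (fst p)\<^sup>2 * (snd p)\<^sup>2 + e / (12 * w) * snd p ^ 4)"
    for p
  have cont: "isCont V1 0" "isCont V2 0" "isCont D1 0" "isCont D2 0" "isCont V 0"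
    unfolding V_def V1_def[abs_def] V2_def[abs_def] D1_def[abs_def] D2_def[abs_def]
    using w by (intro continuous_intros; simp)+
  have "\<forall>\<^sub>F p in nhds 0. w / 4 < V1 p \<and> 1 / 4 < V2 p \<and> 0 < D1 p \<and> 0 < D2 p"
  proof -
    have lim: "(V1 \<longlongrightarrow> V1 0) (nhds 0)" "(V2 \<longlongrightarrow> V2 0) (nhds 0)"
      "(D1 \<longlongrightarrow> D1 0) (nhds 0)" "(D2 \<longlongrightarrow> D2 0) (nhds 0)"
      using cont(1-4) by (simp_all add: continuous_at tendsto_at_iff_tendsto_nhds)
    have "w / 4 < V1 0" "1 / 4 < V2 0" "0 < D1 0" "0 < D2 0"
      using w e by (simp_all add: V1_def V2_def D1_def D2_def)
    from order_tendstoD(1)[OF lim(1) this(1)] order_tendstoD(1)[OF lim(2) this(2)]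
      order_tendstoD(1)[OF lim(3) this(3)] order_tendstoD(1)[OF lim(4) this(4)]
    show ?thesis
      by eventually_elim simp
  qed
  then obtain d where d: "0 < d"
    "\<And>p. norm p < d \<Longrightarrow> w / 4 < V1 p \<and> 1 / 4 < V2 p \<and> 0 < D1 p \<and> 0 < D2 p"
    unfolding eventually_nhds_metric by (auto simp: dist_norm)
  define \<rho> where "\<rho> = d / 2"
  have \<rho>: "0 < \<rho>" "\<And>p. norm p \<le> \<rho> \<Longrightarrow> w / 4 < V1 p \<and> 1 / 4 < V2 p \<and> 0 < D1 p \<and> 0 < D2 p"
    using d by (auto simp: \<rho>_def)
  \<comment> \<open>The bounds on the cofactors give
    \<open>V p \<ge> min (w / 4) (1 / 4) * (norm p)^2\<close>, evaluated here on the circle of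
    radius \<rho>.\<close>
  define m where "m = min (w / 4) (1 / 4) * \<rho>\<^sup>2"
  have m: "0 < m"
    using w \<rho>(1) by (simp add: m_def)
  have barrier: "m \<le> V p" if "norm p = \<rho>" for p
  proof -
    have "\<rho>\<^sup>2 = (fst p)\<^sup>2 + (snd p)\<^sup>2"
      by (simp add: norm_prod_def flip: that)
    then have "m = (fst p)\<^sup>2 * min (w / 4) (1 / 4) + (snd p)\<^sup>2 * min (w / 4) (1 / 4)"
      by (simp add: m_def algebra_simps)
    also have "\<dots> \<le> V p"
      using \<rho>(2)[of p] that unfolding V_def by (intro add_mono mult_left_mono) auto
    finally show ?thesis .
  qed
  have "\<forall>\<^sub>F p in nhds 0. V p < m"
  proof (rule order_tendstoD(2))
    show "(V \<longlongrightarrow> V 0) (nhds 0)"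
      using cont(5) by (simp add: continuous_at tendsto_at_iff_tendsto_nhds)
  qed (use m in \<open>simp add: V_def\<close>)
  then obtain r where r: "0 < r" "\<And>p. norm p < r \<Longrightarrow> V p < m"
    unfolding eventually_nhds_metric by (auto simp: dist_norm)
  show ?thesis
  proof (intro exI[of _ "min r \<rho>"] conjI allI impI notI)
    fix y z :: "real \<Rightarrow> real" and T :: real
    assume "\<forall>t. (y has_real_derivative z t + k / 2 * (y t)\<^sup>2) (at t)"
      and "\<forall>t. (z has_real_derivative - (w * y t + g * (y t)\<^sup>2 + h * y t ^ 3)) (at t)"
      and start: "0 < norm (y 0, z 0)" "norm (y 0, z 0) < min r \<rho>"
      and T: "0 < T" "(y T, z T) = (y 0, z 0)"
    then have y: "(y has_real_derivative z t + k / 2 * (y t)\<^sup>2) (at t)"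
      and z: "(z has_real_derivative - (w * y t + g * (y t)\<^sup>2 + h * y t ^ 3)) (at t)" for t
      by auto
    show False
    proof (rule lyapunov_not_periodic[where x = "\<lambda>t. (y t, z t)" and T = T and V = V and m = m])
      show "continuous_on UNIV (\<lambda>t. (y t, z t))"
        using y z by (intro continuous_intros) (meson DERIV_isCont continuous_at_imp_continuous_on)+
      show "((\<lambda>t. V (y t, z t)) has_real_derivative D (y t, z t)) (at t)" for t
        unfolding V_def V1_def V2_def D_def D1_def D2_def e_def fst_conv snd_conv
        by (rule lienard_lyapunov_derivative[OF w y z])
      show "D (y t, z t) \<le> 0" if "norm (y t, z t) \<le> \<rho>" for t
        using \<rho>(2)[OF that] e(1) w unfolding D_def fst_conv snd_conv neg_le_0_iff_le
        by (intro add_nonneg_nonneg mult_nonneg_nonneg) auto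
      show "D (y 0, z 0) < 0"
      proof -
        have "y 0 \<noteq> 0 \<or> z 0 \<noteq> 0"
          using start(1) by (auto simp: zero_prod_def)
        moreover have "0 < D1 (y 0, z 0)" "0 < D2 (y 0, z 0)"
          using \<rho>(2)[of "(y 0, z 0)"] start(2) by auto
        then have "0 \<le> D1 (y 0, z 0) * y 0 ^ 4" "0 \<le> D2 (y 0, z 0) * (y 0)\<^sup>2 * (z 0)\<^sup>2"
          "0 \<le> e / (12 * w) * z 0 ^ 4"
          "y 0 \<noteq> 0 \<Longrightarrow> 0 < D1 (y 0, z 0) * y 0 ^ 4" "z 0 \<noteq> 0 \<Longrightarrow> 0 < e / (12 * w) * z 0 ^ 4"
          using e(1) w by simp_all
        ultimately show ?thesis
          unfolding D_def fst_conv snd_conv by linarith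
      qed
    qed (use start T r(2) barrier in auto)
  qed (use r \<rho> in auto)
qed

text \<open>The sign of \<open>k * g\<close> is flipped by reversing time and replacing
  \<open>z\<close> by \<open>- z\<close>, which changes \<open>k\<close> to \<open>- k\<close> and
  leaves \<open>g\<close> and \<open>h\<close> alone.\<close>

lemma lienard_focus:
  fixes w g h k :: real
  assumes w: "0 < w" and "k \<noteq> 0" "g \<noteq> 0"
  shows "\<exists>r>0. \<forall>y z T.
      (\<forall>t. (y has_real_derivative z t + k / 2 * (y t)\<^sup>2) (at t)) \<longrightarrow>
      (\<forall>t. (z has_real_derivative - (w * y t + g * (y t)\<^sup>2 + h * y t ^ 3)) (at t)) \<longrightarrow>
      0 < norm (y 0, z 0) \<longrightarrow> norm (y 0, z 0) < r \<longrightarrow> 0 < T \<longrightarrow> (y T, z T) \<noteq> (y 0, z 0)"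
proof (cases "0 < k * g")
  case True
  then show ?thesis
    by (rule lienard_focus_pos[OF w])
next
  case False
  then have "0 < - k * g"
    using assms by (auto simp: not_less mult_le_0_iff mult_less_0_iff)
  from lienard_focus_pos[OF w this, of h] obtain r where r: "0 < r"
    and no: "\<And>y z T. \<lbrakk>\<forall>t. (y has_real_derivative z t + - k / 2 * (y t)\<^sup>2) (at t);
      \<forall>t. (z has_real_derivative - (w * y t + g * (y t)\<^sup>2 + h * y t ^ 3)) (at t);
      0 < norm (y 0, z 0); norm (y 0, z 0) < r; 0 < T\<rbrakk> \<Longrightarrow> (y T, z T) \<noteq> (y 0, z 0)"
    by blast
  show ?thesis
  proof (intro exI[of _ r] conjI allI impI notI)
    fix y z :: "real \<Rightarrow> real" and T :: real
    assume "\<forall>t. (y has_real_derivative z t + k / 2 * (y t)\<^sup>2) (at t)"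
      and "\<forall>t. (z has_real_derivative - (w * y t + g * (y t)\<^sup>2 + h * y t ^ 3)) (at t)"
      and start: "0 < norm (y 0, z 0)" "norm (y 0, z 0) < r"
      and T: "0 < T" "(y T, z T) = (y 0, z 0)"
    then have y: "(y has_real_derivative z t + k / 2 * (y t)\<^sup>2) (at t)"
      and z: "(z has_real_derivative - (w * y t + g * (y t)\<^sup>2 + h * y t ^ 3)) (at t)" for t
      by auto
    have reflect: "((\<lambda>t. f (T - t)) has_real_derivative - f' (T - t)) (at t)"
      if "\<And>t. (f has_real_derivative f' t) (at t)" for f f' :: "real \<Rightarrow> real" and t
    proof -
      have "((\<lambda>t. T - t) has_real_derivative - 1) (at t)"
        by (auto intro!: derivative_eq_intros)
      from DERIV_chain2[OF that this] show ?thesis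
        by simp
    qed
    \<comment> \<open>Reflecting time about \<open>T / 2\<close> exchanges the two endpoints; as
      they coincide, the reversed orbit starts at the same distance from the origin.\<close>
    have "(y (T - T), - z (T - T)) \<noteq> (y (T - 0), - z (T - 0))"
    proof (intro no allI)
      show "((\<lambda>t. y (T - t)) has_real_derivative - z (T - t) + - k / 2 * (y (T - t))\<^sup>2) (at t)" for t
        using reflect[OF y, of t] by simp
      show "((\<lambda>t. - z (T - t)) has_real_derivative
          - (w * y (T - t) + g * (y (T - t))\<^sup>2 + h * y (T - t) ^ 3)) (at t)" for t
        using DERIV_minus[OF reflect[OF z, of t]] by simp
    qed (use start T in \<open>simp_all add: norm_Pair\<close>)
    then show False
      using T by simp
  qed (rule r)
qed

text \<open>A closed orbit through a point near the origin would give a returning orbit of the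
  Lienard system, which the focus lemma forbids. A single bad starting point in each ball is enough
  to refute a center.\<close>

lemma cubic_system_focus:
  fixes a a1 b2 c1 c2 c3 :: real
  defines "F \<equiv> \<lambda>(\<xi>, y). (c1 * y + c2 * y\<^sup>2 + c3 * y ^ 3 + (a + a1 * y) * \<xi>, - \<xi> - (a * y + b2 * y\<^sup>2))"
  assumes pos: "0 < c1 - a * a"
    and "a1 - 2 * b2 \<noteq> 0" "c2 - a * (a1 + b2) \<noteq> 0" and "0 < d"
  obtains p where "0 < norm p" "norm p < d" "\<not> closed_orbit_through F p"
proof -
  from lienard_focus[OF pos, of "a1 - 2 * b2" "c2 - a * (a1 + b2)" "c3 - a1 * b2"] assms
  obtain r where r: "0 < r"
    and no: "\<And>y z T. \<lbrakk>\<forall>t. (y has_real_derivative z t + (a1 - 2 * b2) / 2 * (y t)\<^sup>2) (at t);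
      \<forall>t. (z has_real_derivative - ((c1 - a * a) * y t + (c2 - a * (a1 + b2)) * (y t)\<^sup>2
        + (c3 - a1 * b2) * y t ^ 3)) (at t);
      0 < norm (y 0, z 0); norm (y 0, z 0) < r; 0 < T\<rbrakk> \<Longrightarrow> (y T, z T) \<noteq> (y 0, z 0)"
    by blast
  \<comment> \<open>The starting point is taken on the axis \<open>y = 0\<close>, where
    \<open>z = - \<xi>\<close>, so its norm is the same in both coordinate systems.\<close>
  define \<xi>0 where "\<xi>0 = min r d / 2"
  have \<xi>0: "0 < \<xi>0" "\<xi>0 < r" "\<xi>0 < d"
    using r \<open>0 < d\<close> by (auto simp: \<xi>0_def)
  show thesis
  proof (rule that[of "(\<xi>0, 0)"])
    show "\<not> closed_orbit_through F (\<xi>0, 0)"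
    proof
      assume "closed_orbit_through F (\<xi>0, 0)"
      then obtain x T where T: "0 < T" and x0: "x 0 = (\<xi>0, 0)"
        and x: "\<And>t. (x has_vector_derivative F (x t)) (at t)" and per: "\<And>t. x (t + T) = x t"
        unfolding closed_orbit_through_def by blast
      define \<xi> y where "\<xi> t = fst (x t)" and "y t = snd (x t)" for t
      \<comment> \<open>This is \<open>y' - k / 2 * y^2\<close> with \<open>k = a1 - 2 * b2\<close>:
        the Lienard plane, in which the damping moves from the second equation into the
        first.\<close>
      define z where "z t = - \<xi> t - a * y t - a1 / 2 * (y t)\<^sup>2" for t
      have \<xi>': "(\<xi> has_real_derivative
          c1 * y t + c2 * (y t)\<^sup>2 + c3 * y t ^ 3 + (a + a1 * y t) * \<xi> t) (at t)" for t
        using bounded_linear.has_vector_derivative[OF bounded_linear_fst x, of t]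
        unfolding has_real_derivative_iff_has_vector_derivative \<xi>_def[abs_def] y_def
        by (simp add: F_def split_beta)
      have y': "(y has_real_derivative - \<xi> t - (a * y t + b2 * (y t)\<^sup>2)) (at t)" for t
        using bounded_linear.has_vector_derivative[OF bounded_linear_snd x, of t]
        unfolding has_real_derivative_iff_has_vector_derivative \<xi>_def y_def[abs_def]
        by (simp add: F_def split_beta)
      have "(y T, z T) \<noteq> (y 0, z 0)"
      proof (intro no allI)
        show "(y has_real_derivative z t + (a1 - 2 * b2) / 2 * (y t)\<^sup>2) (at t)" for t
        proof -
          have "z t + (a1 - 2 * b2) / 2 * (y t)\<^sup>2 = - \<xi> t - (a * y t + b2 * (y t)\<^sup>2)"
            by (simp add: z_def field_simps)
          then show ?thesis
            using y'[of t] by simp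
        qed
        show "(z has_real_derivative - ((c1 - a * a) * y t + (c2 - a * (a1 + b2)) * (y t)\<^sup>2
            + (c3 - a1 * b2) * y t ^ 3)) (at t)" for t
          unfolding z_def[abs_def]
          by (rule derivative_eq_intros \<xi>' y' refl)+
            (simp add: algebra_simps power2_eq_square power3_eq_cube)
      qed (use \<xi>0 T x0 in \<open>simp_all add: z_def \<xi>_def y_def norm_Pair\<close>)
      then show False
        using per[of 0] by (simp add: z_def \<xi>_def y_def)
    qed
  qed (use \<xi>0 in \<open>auto simp: norm_Pair\<close>)
qed

section \<open>Linearization\<close>

text \<open>The roots are half of \<open>tr + s\<close> and \<open>tr - s\<close>, with
  \<open>s\<close> a square root of the discriminant. Vanishing real parts force
  \<open>tr = 0\<close> and \<open>Re s = 0\<close>, whence \<open>4 * det = (Im s)^2\<close>, which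
  is positive because the roots are nonzero. Conversely, the imaginary part of the equation gives
  \<open>Re \<mu> * Im \<mu> = 0\<close>.\<close>

lemma imaginary_roots_iff:
  fixes tr det :: real
  shows "(\<forall>\<mu>. \<mu>\<^sup>2 - of_real tr * \<mu> + of_real det = 0 \<longrightarrow> Re \<mu> = 0 \<and> \<mu> \<noteq> 0) \<longleftrightarrow> tr = 0 \<and> 0 < det"
proof
  assume imag: "\<forall>\<mu>. \<mu>\<^sup>2 - of_real tr * \<mu> + of_real det = 0 \<longrightarrow> Re \<mu> = 0 \<and> \<mu> \<noteq> 0"
  define s where "s = csqrt (of_real (tr\<^sup>2 - 4 * det))"
  have s: "s\<^sup>2 = of_real tr ^ 2 - 4 * of_real det"
    by (simp add: s_def)
  have root: "Re \<mu> = 0 \<and> \<mu> \<noteq> 0"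
    if "\<mu> = (of_real tr + s) / 2 \<or> \<mu> = (of_real tr - s) / 2" for \<mu>
  proof -
    have "s = 2 * \<mu> - of_real tr \<or> s = of_real tr - 2 * \<mu>"
      using that by (elim disjE; hypsubst) (simp_all add: add_divide_distrib diff_divide_distrib)
    then have "\<mu>\<^sup>2 - of_real tr * \<mu> + of_real det = (s\<^sup>2 - (of_real tr ^ 2 - 4 * of_real det)) / 4"
      by (elim disjE; simp only:; simp add: power2_eq_square algebra_simps)
    then have "\<mu>\<^sup>2 - of_real tr * \<mu> + of_real det = 0"
      by (simp only: s) simp
    with imag show ?thesis
      by blast
  qed
  have ne: "of_real tr + s \<noteq> 0"
    using root[of "(of_real tr + s) / 2"] by auto
  have "Re (of_real tr + s) = 0" "Re (of_real tr - s) = 0"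
    using root[of "(of_real tr + s) / 2"] root[of "(of_real tr - s) / 2"] by simp_all
  then have re: "tr = 0" "Re s = 0"
    by simp_all
  with ne have "Im s \<noteq> 0"
    by (simp add: complex_eq_iff)
  have "Re (s\<^sup>2) = - 4 * det"
    by (simp add: s re(1))
  then have "4 * det = (Im s)\<^sup>2"
    using re(2) by (simp add: power2_eq_square)
  moreover have "0 < (Im s)\<^sup>2"
    using \<open>Im s \<noteq> 0\<close> by simp
  ultimately show "tr = 0 \<and> 0 < det"
    using re(1) by linarith
next
  assume *: "tr = 0 \<and> 0 < det"
  show "\<forall>\<mu>. \<mu>\<^sup>2 - of_real tr * \<mu> + of_real det = 0 \<longrightarrow> Re \<mu> = 0 \<and> \<mu> \<noteq> 0"
  proof (intro allI impI)
    fix \<mu> :: complex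
    assume "\<mu>\<^sup>2 - of_real tr * \<mu> + of_real det = 0"
    then have eq: "(Re \<mu>)\<^sup>2 - (Im \<mu>)\<^sup>2 + det = 0" "Re \<mu> * Im \<mu> = 0"
      using * by (auto simp: complex_eq_iff power2_eq_square)
    \<comment> \<open>A real root would make the sum of a square and the positive \<open>det\<close>
      vanish.\<close>
    then have "Im \<mu> \<noteq> 0"
      using * by (auto simp: add_nonneg_eq_0_iff)
    then show "Re \<mu> = 0 \<and> \<mu> \<noteq> 0"
      using eq by auto
  qed
qed

lemma has_derivative_cubic_system:
  fixes a0 a1 b1 b2 c1 c2 c3 :: real
  shows "((\<lambda>(\<xi>, y). (c1 * y + c2 * y\<^sup>2 + c3 * y ^ 3 + (a0 + a1 * y) * \<xi>, - \<xi> - (b1 * y + b2 * y\<^sup>2)))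
    has_derivative (\<lambda>(u, v). (c1 * v + a0 * u, - u - b1 * v))) (at (0, 0))"
proof -
  have fst: "(fst has_derivative fst) (at (0, 0 :: real))"
    and snd: "(snd has_derivative snd) (at (0 :: real, 0))"
    by (auto intro: bounded_linear_imp_has_derivative bounded_linear_fst bounded_linear_snd)
  have "((\<lambda>y. c1 * y + c2 * y\<^sup>2 + c3 * y ^ 3) has_real_derivative c1) (at (snd (0 :: real, 0)))"
    "((\<lambda>y. a0 + a1 * y) has_real_derivative a1) (at (snd (0 :: real, 0)))"
    "((\<lambda>y. b1 * y + b2 * y\<^sup>2) has_real_derivative b1) (at (snd (0 :: real, 0)))"
    by (auto intro!: derivative_eq_intros)
  note cubic = this[THEN DERIV_compose_FDERIV[where g = snd and s = UNIV, OF _ snd]]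
  have "((\<lambda>p. (c1 * snd p + c2 * (snd p)\<^sup>2 + c3 * snd p ^ 3 + (a0 + a1 * snd p) * fst p,
      - fst p - (b1 * snd p + b2 * (snd p)\<^sup>2))) has_derivative
    (\<lambda>p. (snd p * c1 + ((a0 + a1 * snd (0 :: real, 0 :: real)) * fst p + snd p * a1 * fst (0 :: real, 0 :: real)),
      - fst p - snd p * b1))) (at (0, 0))"
    by (intro has_derivative_Pair has_derivative_add has_derivative_diff has_derivative_minus
          has_derivative_mult fst cubic)
  then show ?thesis
    unfolding case_prod_beta' by (rule has_derivative_eq_rhs) (simp add: fun_eq_iff mult.commute)
qed

section \<open>Characterization of the non-degenerate centers of the cubic system\<close>

theorem theorem3:
  fixes a0 a1 b1 b2 c1 c2 c3 :: real
  defines "P1 \<equiv> (\<lambda>y::real. a0 + a1 * y)"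
      and "P2 \<equiv> (\<lambda>y::real. b1 * y + b2 * y^2)"
      and "P3 \<equiv> (\<lambda>y::real. c1 * y + c2 * y^2 + c3 * y^3)"
  shows "nondegenerate_center (\<lambda>(xi, y). (P3 y + P1 y * xi, - xi - P2 y)) (0, 0) \<longleftrightarrow>
           a0 - b1 = 0 \<and> c1 - a0 * b1 > 0 \<and>
           (a1 - 2 * b2 = 0 \<or> c2 - a0 * (a1 + b2) = 0)"
proof -
  define F where "F = (\<lambda>(\<xi> :: real, y :: real).
    (c1 * y + c2 * y\<^sup>2 + c3 * y ^ 3 + (a0 + a1 * y) * \<xi>, - \<xi> - (b1 * y + b2 * y\<^sup>2)))"
  have F_eq: "(\<lambda>(xi, y). (P3 y + P1 y * xi, - xi - P2 y)) = F"
    by (simp add: F_def P1_def P2_def P3_def)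
  have deriv: "(F has_derivative (\<lambda>(u, v). (c1 * v + a0 * u, - u - b1 * v))) (at (0, 0))"
    unfolding F_def by (rule has_derivative_cubic_system)
  \<comment> \<open>The characteristic polynomial, with trace \<open>a0 - b1\<close> and determinant
    \<open>c1 - a0 * b1\<close> read off from the derivative.\<close>
  have "lin_eigenvalue F (0, 0) \<mu> \<longleftrightarrow>
      \<mu>\<^sup>2 - of_real (a0 - b1) * \<mu> + of_real (c1 - a0 * b1) = 0" for \<mu>
    unfolding lin_eigenvalue_def jac11_def jac12_def jac21_def jac22_def
      frechet_derivative_at[OF deriv, symmetric]
    by (simp add: algebra_simps power2_eq_square)
  then have linear: "(\<forall>\<mu>. lin_eigenvalue F (0, 0) \<mu> \<longrightarrow> Re \<mu> = 0 \<and> \<mu> \<noteq> 0) \<longleftrightarrow>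
      a0 - b1 = 0 \<and> 0 < c1 - a0 * b1"
    using imaginary_roots_iff[of "a0 - b1" "c1 - a0 * b1"] by simp
  \<comment> \<open>Once the linear conditions hold, \<open>b1\<close> equals \<open>a0\<close>, so
    the reversible and focus results for the cubic system decide whether all nearby orbits
    close.\<close>
  have closed: "(\<exists>r>0. \<forall>q. 0 < dist q (0, 0) \<and> dist q (0, 0) < r \<longrightarrow> closed_orbit_through F q) \<longleftrightarrow>
      a1 - 2 * b2 = 0 \<or> c2 - a0 * (a1 + b2) = 0"
    if "a0 - b1 = 0" and pos: "0 < c1 - a0 * b1"
  proof -
    have b1: "b1 = a0"
      using that by simp
    have F: "F = (\<lambda>(\<xi>, y).
      (c1 * y + c2 * y\<^sup>2 + c3 * y ^ 3 + (a0 + a1 * y) * \<xi>, - \<xi> - (a0 * y + b2 * y\<^sup>2)))"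
      unfolding F_def b1 ..
    have dist: "dist q (0, 0) = norm q" for q :: "real \<times> real"
      by (simp add: dist_norm flip: zero_prod_def)
    show ?thesis
      unfolding dist
    proof
      assume "a1 - 2 * b2 = 0 \<or> c2 - a0 * (a1 + b2) = 0"
      from cubic_system_closed_orbits[OF pos[unfolded b1] this, of c3, folded F]
      show "\<exists>r>0. \<forall>q. 0 < norm q \<and> norm q < r \<longrightarrow> closed_orbit_through F q"
        by metis
    next
      assume "\<exists>r>0. \<forall>q. 0 < norm q \<and> norm q < r \<longrightarrow> closed_orbit_through F q"
      then obtain r where r: "0 < r" "\<And>q. \<lbrakk>0 < norm q; norm q < r\<rbrakk> \<Longrightarrow> closed_orbit_through F q"
        by blast
      show "a1 - 2 * b2 = 0 \<or> c2 - a0 * (a1 + b2) = 0"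
      proof (rule ccontr)
        assume "\<not> ?thesis"
        then have "a1 - 2 * b2 \<noteq> 0" "c2 - a0 * (a1 + b2) \<noteq> 0"
          by auto
        from cubic_system_focus[OF pos[unfolded b1] this r(1), of c3, folded F] r(2)
        show False
          by metis
      qed
    qed
  qed
  have "F (0, 0) = 0" "F differentiable (at (0, 0))"
    using deriv by (auto simp: F_def differentiable_def zero_prod_def)
  then show ?thesis
    unfolding F_eq nondegenerate_center_def linear using closed by auto
qed

end
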